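(* Let $a,b$ be coprime positive integers with $a>1$, and define $f\colon \mathbb{Z}^+\to\mathbb{Z}^+$ by $f(z)=az+b$. There exists $M\in\mathbb{Z}^+$ such that for every $z\in\mathbb{Z}^+$ with $z>M$, not all of the numbers $f(z),f^2(z),\dots$ are prime, and the length $\ell(z)$ of the rooted Cunningham chain with root $z$ satisfies $\ell(z)<z$.
   Context: $f^n$ denotes the $n$-fold iterate of $f$. For a positive integer $z$, the rooted Cunningham chain with root $z$ is the list $\{f(z),f^2(z),\dots,f^{\ell(z)}(z)\}$ where all listed elements are prime and $f^{\ell(z)+1}(z)$ is composite; i.e. $\ell(z)\ge 0$ is the number of consecutive terms $f(z),f^2(z),\dots$ that are prime before the first composite term. Note $z$ itself is not part of the list and need not be prime. *)

theory Defs
  imports "HOL-Computational_Algebra.Primes"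
begin

text \<open>Positive integers are rendered as naturals with explicit positivity; for \<open>b > 0\<close> the map
  below sends positive numbers to positive numbers.\<close>

definition affine_map :: "nat \<Rightarrow> nat \<Rightarrow> nat \<Rightarrow> nat"
  where "affine_map a b z = a * z + b"

definition composite :: "nat \<Rightarrow> bool"
  where "composite n \<longleftrightarrow> n > 1 \<and> \<not> prime n"

text \<open>The root \<open>z\<close> is not a member of the chain and need not be prime.\<close>

definition is_rooted_chain :: "(nat \<Rightarrow> nat) \<Rightarrow> nat \<Rightarrow> nat list \<Rightarrow> bool"
  where "is_rooted_chain f z xs \<longleftrightarrow>
    xs = map (\<lambda>i. (f ^^ i) z) [1..<length xs + 1] \<and>
    (\<forall>p \<in> set xs. prime p) \<and> composite ((f ^^ (length xs + 1)) z)"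

lemma is_rooted_chain_unique:
  assumes "is_rooted_chain f z xs" "is_rooted_chain f z ys"
  shows "xs = ys"
proof -
  have *: False if xs: "is_rooted_chain f z xs" and ys: "is_rooted_chain f z ys"
    and less: "length xs < length ys" for xs ys
  proof -
    have "ys = map (\<lambda>i. (f ^^ i) z) [1..<length ys + 1]"
      using ys by (simp add: is_rooted_chain_def)
    then have "set ys = (\<lambda>i. (f ^^ i) z) ` {1..<length ys + 1}"
      by (metis set_map set_upt)
    moreover have "length xs + 1 \<in> {1..<length ys + 1}"
      using less by simp
    ultimately have "(f ^^ (length xs + 1)) z \<in> set ys"
      by blast
    then have "prime ((f ^^ (length xs + 1)) z)"
      using ys unfolding is_rooted_chain_def by blast
    then show False
      using xs unfolding is_rooted_chain_def composite_def by blast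
  qed
  have "length xs = length ys"
    using * assms by (meson linorder_neqE_nat)
  then show ?thesis
    using assms unfolding is_rooted_chain_def by metis
qed

text \<open>These two are unspecified when all of \<open>f z, f (f z), \<dots>\<close> are prime; otherwise (for \<open>f\<close>
  an affine map as above and \<open>z > 0\<close>) the chain exists, and it is unique by the preceding lemma.\<close>

definition rooted_chain :: "(nat \<Rightarrow> nat) \<Rightarrow> nat \<Rightarrow> nat list"
  where "rooted_chain f z = (THE xs. is_rooted_chain f z xs)"

definition chain_length :: "(nat \<Rightarrow> nat) \<Rightarrow> nat \<Rightarrow> nat"
  where "chain_length f z = length (rooted_chain f z)"

lemma is_rooted_chain_rooted_chain:
  assumes "a > 1" "b > 0" "z > 0" "\<not> (\<forall>n\<ge>1. prime ((affine_map a b ^^ n) z))"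
  shows "is_rooted_chain (affine_map a b) z (rooted_chain (affine_map a b) z)"
proof -
  let ?f = "affine_map a b"
  let ?l = "LEAST l. \<not> prime ((?f ^^ (l + 1)) z)"
  let ?xs = "map (\<lambda>i. (?f ^^ i) z) [1..<?l + 1]"
  have pos: "(?f ^^ n) z > 0" for n
    using assms by (induction n) (auto simp: affine_map_def)
  have gt1: "(?f ^^ (n + 1)) z > 1" for n
  proof -
    have "a * (?f ^^ n) z > 0"
      using pos[of n] assms by simp
    then have "a * (?f ^^ n) z + b > 1"
      using assms(2) by linarith
    then show ?thesis
      by (simp add: affine_map_def)
  qed
  obtain n where n: "n \<ge> 1" "\<not> prime ((?f ^^ n) z)"
    using assms(4) by blast
  then have "\<not> prime ((?f ^^ ((n - 1) + 1)) z)"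
    by simp
  then have last: "\<not> prime ((?f ^^ (?l + 1)) z)"
    by (rule LeastI)
  have primes: "prime ((?f ^^ i) z)" if "1 \<le> i" "i < ?l + 1" for i
  proof -
    have "i - 1 < ?l"
      using that by linarith
    then have "prime ((?f ^^ ((i - 1) + 1)) z)"
      using not_less_Least by blast
    then show ?thesis
      using that by simp
  qed
  have len: "length ?xs = ?l"
    by simp
  have "\<forall>p \<in> set ?xs. prime p"
  proof
    fix p assume "p \<in> set ?xs"
    then obtain i where "i \<in> {1..<?l + 1}" "p = (?f ^^ i) z"
      unfolding set_map set_upt by blast
    then show "prime p"
      using primes[of i] by (metis atLeastLessThan_iff)
  qed
  then have "is_rooted_chain ?f z ?xs"
    unfolding is_rooted_chain_def composite_def len using last gt1[of ?l] by (intro conjI refl)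
  then show ?thesis
    unfolding rooted_chain_def by (metis theI is_rooted_chain_unique)
qed

end

theory Submission
  imports Defs "HOL-Number_Theory.Residues"
begin

text \<open>Write \<open>c k = b * (1 + a + \<dots> + a ^ (k - 1))\<close> for the \<open>k\<close>-th iterate of \<open>f\<close> at \<open>0\<close>. If a prime \<open>p\<close>
  not dividing \<open>a\<close> divides \<open>z - c k\<close>, then \<open>z\<close> is the \<open>k\<close>-th iterate of \<open>0\<close> modulo \<open>p\<close>; since \<open>f\<close> has a
  period \<open>P \<le> p\<close> modulo \<open>p\<close>, some iterate \<open>f\<^sup>n z\<close> with \<open>1 \<le> n \<le> P \<le> z\<close> is divisible by \<open>p\<close>, hence
  composite. Otherwise each of the \<open>a + 1\<close> numbers \<open>z - c k\<close>, \<open>k \<le> a\<close>, has only prime factors dividing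
  \<open>a\<close>. There are at most \<open>a\<close> such primes, so for large \<open>z\<close> two of these numbers share a prime power
  factor exceeding their difference, which is impossible.\<close>

lemma affine_map_funpow:
  "(affine_map a b ^^ n) z = a ^ n * z + b * (\<Sum>i<n. a ^ i)"
proof (induction n)
  case (Suc n)
  have "(\<Sum>i<Suc n. a ^ i) = 1 + a * (\<Sum>i<n. a ^ i)"
    by (simp only: sum.lessThan_Suc_shift sum_distrib_left) simp
  with Suc show ?case
    by (simp add: affine_map_def algebra_simps del: sum.lessThan_Suc)
qed simp

text \<open>\<open>f ^^ n\<close> is affine with slope \<open>a ^ n\<close>. For
  \<open>y = z - c k\<close> this reduces divisibility of the \<open>n\<close>-th iterate of
  \<open>z\<close> by a prime \<open>p\<close> dividing \<open>y\<close> to that of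
  \<open>c (n + k)\<close>.\<close>

lemma affine_map_funpow_add_orbit_zero:
  "(affine_map a b ^^ n) (y + (affine_map a b ^^ k) 0) = a ^ n * y + (affine_map a b ^^ (n + k)) 0"
proof -
  have "(affine_map a b ^^ (n + k)) 0 = (affine_map a b ^^ n) ((affine_map a b ^^ k) 0)"
    by (simp add: funpow_add)
  then show ?thesis
    by (simp add: affine_map_funpow algebra_simps)
qed

lemma affine_map_funpow_less:
  assumes "a > 1" "b > 0" "i < j"
  shows "(affine_map a b ^^ i) z < (affine_map a b ^^ j) z"
proof -
  have "y < affine_map a b y" for y
    using mult_le_mono1[of 1 a y] assms(1,2) unfolding affine_map_def by linarith
  then have "strict_mono (\<lambda>n. (affine_map a b ^^ n) z)"
    by (simp add: strict_mono_Suc_iff)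
  then show ?thesis
    using \<open>i < j\<close> by (rule strict_monoD)
qed

text \<open>If \<open>a\<close> is 1 modulo \<open>p\<close>, the geometric sum is congruent to
  \<open>m\<close>, so \<open>P = p\<close> works. Otherwise Fermat gives \<open>P = p - 1\<close>:
  \<open>p\<close> divides \<open>a ^ m - 1\<close> but not \<open>a - 1\<close>, hence divides the
  geometric sum.\<close>

lemma affine_map_period_mod_prime:
  fixes a b p :: nat
  assumes p: "prime p" and "\<not> p dvd a"
  obtains P where "0 < P" "P \<le> p" "\<And>m. P dvd m \<Longrightarrow> p dvd (affine_map a b ^^ m) 0"
proof (cases "[a = 1] (mod p)")
  case True
  have "p dvd (affine_map a b ^^ m) 0" if "p dvd m" for m
  proof -
    have "[(\<Sum>i<m. a ^ i) = (\<Sum>i<m. 1 ^ i)] (mod p)"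
      by (intro cong_sum cong_pow True)
    then have "p dvd (\<Sum>i<m. a ^ i)"
      using that by (simp add: cong_dvd_iff)
    then show ?thesis
      by (simp add: affine_map_funpow)
  qed
  then show ?thesis
    using that[of p] prime_gt_0_nat[OF p] by blast
next
  case False
  have "p dvd (affine_map a b ^^ m) 0" if "(p - 1) dvd m" for m
  proof -
    from that obtain t where m: "m = (p - 1) * t" by (rule dvdE)
    have "[(a ^ (p - 1)) ^ t = 1 ^ t] (mod p)"
      by (intro cong_pow fermat_theorem assms)
    then have "[int a ^ m = 1] (mod int p)"
      unfolding m power_mult by (metis cong_int_iff of_nat_1 of_nat_power power_one)
    then have "int p dvd int a ^ m - 1"
      by (simp add: cong_iff_dvd_diff)
    then have "int p dvd (int a - 1) * (\<Sum>i<m. int a ^ i)"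
      by (simp add: power_diff_1_eq)
    moreover have "\<not> int p dvd int a - 1"
      using False by (metis cong_iff_dvd_diff cong_int_iff of_nat_1)
    ultimately have "int p dvd (\<Sum>i<m. int a ^ i)"
      using p by (metis prime_dvd_mult_iff prime_nat_int_transfer)
    then have "int p dvd int (\<Sum>i<m. a ^ i)"
      by simp
    then have "p dvd (\<Sum>i<m. a ^ i)"
      by (simp only: int_dvd_int_iff)
    then show ?thesis
      by (simp add: affine_map_funpow)
  qed
  then show ?thesis
    using that[of "p - 1"] prime_gt_1_nat[OF p] by auto
qed

lemma nonprime_iterate_if_prime_dvd_diff:
  fixes a b p :: nat
  assumes "a > 1" "b > 0" and p: "prime p" "\<not> p dvd a"
    and z: "(affine_map a b ^^ k) 0 < z" "p dvd z - (affine_map a b ^^ k) 0"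
  obtains n where "1 \<le> n" "n \<le> z" "\<not> prime ((affine_map a b ^^ n) z)"
proof -
  let ?f = "affine_map a b"
  obtain P where P: "0 < P" "P \<le> p" "\<And>m. P dvd m \<Longrightarrow> p dvd (?f ^^ m) 0"
    using affine_map_period_mod_prime[OF p] by blast
  \<comment> \<open>The least positive \<open>n\<close> with \<open>P dvd n + k\<close>; it equals
    \<open>P\<close>, not 0, when \<open>P\<close> divides \<open>k\<close>.\<close>
  define n where "n = P - k mod P"
  have n: "1 \<le> n" "n \<le> P"
    using P(1) by (auto simp: n_def Suc_leI)
  have "k mod P < P" using P(1) by simp
  then have "n + k = P + P * (k div P)"
    unfolding n_def using mult_div_mod_eq[of P k] by linarith
  then have "P dvd n + k" by simp
  moreover have "(?f ^^ n) z = a ^ n * (z - (?f ^^ k) 0) + (?f ^^ (n + k)) 0"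
    using affine_map_funpow_add_orbit_zero[of n a b "z - (?f ^^ k) 0" k]
    unfolding le_add_diff_inverse2[OF less_imp_le[OF z(1)]] .
  ultimately have dvd: "p dvd (?f ^^ n) z"
    using P(3) z(2) by simp
  have "p \<le> z"
    using z dvd_imp_le[OF z(2)] by linarith
  moreover have "z < (?f ^^ n) z"
    using affine_map_funpow_less[OF assms(1,2), of 0 n z] n(1) by simp
  \<comment> \<open>The divisor \<open>p\<close> is proper, as
    \<open>p \<le> z < (?f ^^ n) z\<close>.\<close>
  ultimately have "\<not> prime ((?f ^^ n) z)"
    using primes_dvd_imp_eq[OF p(1) _ dvd] by linarith
  then show ?thesis
    using that[of n] n P(2) \<open>p \<le> z\<close> by linarith
qed

text \<open>If all prime power factors were at most \<open>D\<close>, their product \<open>x\<close>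
  would be at most \<open>D ^ card S\<close>.\<close>

lemma ex_large_prime_power_factor:
  fixes x D :: nat
  assumes "finite S" "prime_factors x \<subseteq> S" "D > 0" "D ^ card S < x"
  obtains p where "p \<in> S" "D < p ^ multiplicity p x"
proof -
  have "\<exists>p\<in>prime_factors x. D < p ^ multiplicity p x"
  proof (rule ccontr)
    assume "\<not> ?thesis"
    then have le: "p ^ multiplicity p x \<le> D" if "p \<in> prime_factors x" for p
      using that by (meson not_less)
    have "x = (\<Prod>p\<in>prime_factors x. p ^ multiplicity p x)"
      using assms(4) by (simp add: prod_prime_factors)
    also have "\<dots> \<le> (\<Prod>p\<in>prime_factors x. D)"
      using le by (intro prod_mono) auto
    also have "\<dots> \<le> D ^ card S"
      using assms by (simp add: power_increasing card_mono)
    finally show False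
      using assms(4) by simp
  qed
  then show ?thesis
    using that assms(2) by blast
qed

text \<open>By pigeonhole two of the numbers have their large prime power factor at the same prime;
  the smaller of these two powers divides both numbers.\<close>

lemma ex_pair_large_gcd:
  fixes x :: "nat \<Rightarrow> nat"
  assumes "finite S" "card S < n" "D > 0"
    and "\<And>k. k < n \<Longrightarrow> prime_factors (x k) \<subseteq> S" "\<And>k. k < n \<Longrightarrow> D ^ card S < x k"
  obtains i j where "i < j" "j < n" "D < gcd (x i) (x j)"
proof -
  have "\<forall>k\<in>{..<n}. \<exists>p. p \<in> S \<and> D < p ^ multiplicity p (x k)"
    using ex_large_prime_power_factor assms by (metis lessThan_iff)
  then obtain q where q: "\<And>k. k < n \<Longrightarrow> q k \<in> S \<and> D < q k ^ multiplicity (q k) (x k)"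
    by (metis lessThan_iff)
  have "\<not> inj_on q {..<n}"
    using card_inj_on_le[of q "{..<n}" S] q assms(1,2) by fastforce
  then obtain i j where ij: "i < j" "j < n" "q i = q j"
    by (metis inj_onI lessThan_iff linorder_neqE_nat)
  let ?e = "min (multiplicity (q i) (x i)) (multiplicity (q i) (x j))"
  have "D < q i ^ ?e"
    using q[of i] q[of j] ij by (auto simp: min_def)
  also have "q i ^ ?e \<le> gcd (x i) (x j)"
  proof (rule dvd_imp_le)
    show "q i ^ ?e dvd gcd (x i) (x j)"
      by (intro gcd_greatest multiplicity_dvd') auto
    show "0 < gcd (x i) (x j)"
      using assms(5)[OF ij(2)] by simp
  qed
  finally show ?thesis
    using that ij by blast
qed

text \<open>A nonprime iterate guarantees that the chain exists, so \<open>rooted_chain\<close> is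
  well specified; a chain of length at least \<open>n\<close> would list the nonprime
  \<open>n\<close>-th iterate.\<close>

lemma chain_length_less:
  assumes "a > 1" "b > 0" "z > 0" "n \<ge> 1" "\<not> prime ((affine_map a b ^^ n) z)"
  shows "chain_length (affine_map a b) z < n"
proof (rule ccontr)
  let ?f = "affine_map a b" and ?xs = "rooted_chain (affine_map a b) z"
  assume "\<not> ?thesis"
  then have "n \<le> length ?xs"
    by (simp add: chain_length_def)
  then have n: "n \<in> set [1..<length ?xs + 1]"
    using assms(4) unfolding set_upt atLeastLessThan_iff by linarith
  have xs: "is_rooted_chain ?f z ?xs"
    using assms by (intro is_rooted_chain_rooted_chain) auto
  then have "set ?xs = (\<lambda>i. (?f ^^ i) z) ` set [1..<length ?xs + 1]"
    unfolding is_rooted_chain_def by (metis set_map)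
  then have "(?f ^^ n) z \<in> set ?xs"
    using n by blast
  then show False
    using xs assms(5) by (simp add: is_rooted_chain_def)
qed

theorem theorem2:
  fixes a b :: nat
  assumes "a > 0" and "b > 0" and "coprime a b" and "a > 1"
  shows "\<exists>M::nat. M > 0 \<and> (\<forall>z::nat. z > 0 \<and> z > M \<longrightarrow>
           \<not> (\<forall>n\<ge>1. prime ((affine_map a b ^^ n) z)) \<and>
           chain_length (affine_map a b) z < z)"
proof -
  let ?f = "affine_map a b" and ?S = "prime_factors a"
  \<comment> \<open>The largest of \<open>c 0\<close>, ..., \<open>c a\<close>, hence a bound for
    all their differences.\<close>
  define D where "D = (?f ^^ a) 0"
  have c_less: "(?f ^^ i) 0 < (?f ^^ j) 0" if "i < j" for i j
    using affine_map_funpow_less assms that by blast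
  have c_le: "(?f ^^ k) 0 \<le> D" if "k \<le> a" for k
    using c_less[of k a] that by (cases "k = a") (auto simp: D_def)
  have "D > 0"
    using c_less[of 0 a] assms by (simp add: D_def)
  have "?S \<subseteq> {1..a}"
    using assms(1) by (auto simp: in_prime_factors_iff Suc_leI prime_gt_0_nat intro: dvd_imp_le)
  then have card: "card ?S < Suc a"
    using card_mono[of "{1..a}" ?S] by simp
  \<comment> \<open>The summand \<open>D\<close> pays for subtracting \<open>c k\<close>, so that
    every \<open>z - c k\<close> still exceeds \<open>D ^ card ?S\<close>.\<close>
  have ex: "\<exists>n\<ge>1. n \<le> z \<and> \<not> prime ((?f ^^ n) z)" if z: "z > D + D ^ card ?S" for z
  proof -
    define x where "x k = z - (?f ^^ k) 0" for k
    have large: "D ^ card ?S < x k" if "k < Suc a" for k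
      using z c_le[of k] that by (simp add: x_def)
    have "\<exists>k<Suc a. \<not> prime_factors (x k) \<subseteq> ?S"
    proof (rule ccontr)
      assume "\<not> ?thesis"
      then obtain i j where ij: "i < j" "j < Suc a" "D < gcd (x i) (x j)"
        using ex_pair_large_gcd[of ?S "Suc a" D x] card large \<open>D > 0\<close> by blast
      \<comment> \<open>The order flips because \<open>x\<close> is decreasing; both differences are
        positive, so the gcd, dividing them, is at most \<open>D\<close>.\<close>
      have eq: "x i - x j = (?f ^^ j) 0 - (?f ^^ i) 0"
        using c_less[OF ij(1)] c_le[of j] ij(2) z by (simp add: x_def)
      have "gcd (x i) (x j) dvd x i - x j"
        by (intro dvd_diff_nat) auto
      then have "gcd (x i) (x j) \<le> x i - x j"
        using c_less[OF ij(1)] by (intro dvd_imp_le) (auto simp: eq)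
      also have "\<dots> \<le> D"
        using c_le[of j] ij(2) by (simp add: eq)
      finally show False
        using ij(3) by simp
    qed
    then obtain k p where k: "k < Suc a" and p: "p \<in> prime_factors (x k)" "p \<notin> ?S"
      by blast
    then have "prime p" "\<not> p dvd a" "p dvd z - (?f ^^ k) 0"
      using assms(1) by (auto simp: in_prime_factors_iff x_def)
    moreover have "(?f ^^ k) 0 < z"
      using c_le[of k] k z by simp
    ultimately show ?thesis
      using nonprime_iterate_if_prime_dvd_diff assms(2,4) by metis
  qed
  have "\<not> (\<forall>n\<ge>1. prime ((?f ^^ n) z)) \<and> chain_length ?f z < z"
    if "z > 0" "z > D + D ^ card ?S" for z
    using ex[OF that(2)] chain_length_less[OF assms(4,2) that(1)] by (meson less_le_trans)
  then show ?thesis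
    using \<open>D > 0\<close> by (intro exI[of _ "D + D ^ card ?S"]) auto
qed

end
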